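(* Let $b^*(n)$ denote the bias threshold of the $(1:b)$ Maker--Breaker directed triangle game on the parity tournament $\Pi(n)$. Then, for all sufficiently large $n$, $$\sqrt{\left(\tfrac{1}{12}+o(1)\right)n}\ \le\ b^*(n)\ \le\ \sqrt{\left(\tfrac{8}{3}+o(1)\right)n},$$ where each $o(1)$ denotes some function of $n$ tending to $0$ as $n\to\infty$.
   Context: Let $V_n=\{1,2,\ldots,n\}$, and let $(i,j)$ denote the directed edge from $i$ to $j$. A tournament on $V_n$ is a directed graph containing, for all distinct $i,j\in V_n$, precisely one of $(i,j)$ and $(j,i)$, with no loops or parallel edges. Parity tournament $\Pi(n)$: the tournament on $V_n$ in which, for $i<j$, the edge is $(i,j)$ if $i+j$ is odd, and is $(j,i)$ if $i+j$ is even. A directed triangle $(i,j,k)$ in a tournament $T$ consists of three distinct vertices $i,j,k$ with $(i,j),(j,k),(k,i)\in E(T)$. $(1:b)$ Maker--Breaker directed triangle game on a tournament $T$ ($b$ a positive integer): the board is the edge set $E(T)$. Maker moves first; the players alternate, Maker claiming exactly one previously untaken edge in each of her turns and Breaker claiming exactly $b$ previously untaken edges in each of hers (all the remaining edges if fewer than $b$ remain), until all edges are exhausted. Maker wins if she has claimed all three edges of some directed triangle of $T$; otherwise Breaker wins. The bias threshold $b^*(n)$ is the minimum positive integer $b$ for which Breaker has a winning strategy in the $(1:b)$ game on $\Pi(n)$; thus Maker wins for $b<b^*(n)$ and Breaker wins for $b\ge b^*(n)$. *)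

theory Defs
  imports Complex_Main
begin

text \<open>A directed graph is represented by its vertex set together with its edge set, the pair
  \<open>(i, j)\<close> being the edge from \<open>i\<close> to \<open>j\<close>. Using a set of pairs rules out parallel edges.\<close>

definition tournament :: "'a set \<Rightarrow> 'a rel \<Rightarrow> bool" where
  "tournament V E \<longleftrightarrow> E \<subseteq> V \<times> V \<and> (\<forall>i\<in>V. (i, i) \<notin> E) \<and>
     (\<forall>i\<in>V. \<forall>j\<in>V. i \<noteq> j \<longrightarrow> ((i, j) \<in> E) \<noteq> ((j, i) \<in> E))"

definition parity_tournament :: "nat \<Rightarrow> nat rel" where
  "parity_tournament n =
     {(i, j). i \<in> {1..n} \<and> j \<in> {1..n} \<and> (i < j \<and> odd (i + j) \<or> j < i \<and> even (i + j))}"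

lemma tournament_parity_tournament: "tournament {1..n} (parity_tournament n)"
  unfolding tournament_def parity_tournament_def
  by (auto simp: neq_iff add.commute)

definition directed_triangle :: "'a rel \<Rightarrow> 'a \<Rightarrow> 'a \<Rightarrow> 'a \<Rightarrow> bool" where
  "directed_triangle E i j k \<longleftrightarrow>
     i \<noteq> j \<and> j \<noteq> k \<and> i \<noteq> k \<and> (i, j) \<in> E \<and> (j, k) \<in> E \<and> (k, i) \<in> E"

text \<open>A round \<open>(e, F)\<close> consists of Maker's edge \<open>e\<close> followed by Breaker's set \<open>F\<close> of edges; a play
  is the list of its rounds in chronological order. If Maker takes the last edge of the board,
  then \<open>F = {}\<close> in that round.\<close>

type_synonym 'a round = "('a \<times> 'a) \<times> 'a rel"

definition untaken :: "'a rel \<Rightarrow> 'a round list \<Rightarrow> 'a rel" where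
  "untaken E ps = E - (\<Union>(e, F)\<in>set ps. insert e F)"

definition breaker_move :: "'a rel \<Rightarrow> nat \<Rightarrow> 'a round list \<Rightarrow> 'a \<times> 'a \<Rightarrow> 'a rel \<Rightarrow> bool" where
  "breaker_move E b ps e F \<longleftrightarrow>
     F \<subseteq> untaken E ps - {e} \<and> card F = min b (card (untaken E ps - {e}))"

definition legal_play :: "'a rel \<Rightarrow> nat \<Rightarrow> 'a round list \<Rightarrow> bool" where
  "legal_play E b ps \<longleftrightarrow>
     (\<forall>r<length ps. fst (ps ! r) \<in> untaken E (take r ps) \<and>
        breaker_move E b (take r ps) (fst (ps ! r)) (snd (ps ! r)))"

definition complete_play :: "'a rel \<Rightarrow> nat \<Rightarrow> 'a round list \<Rightarrow> bool" where
  "complete_play E b ps \<longleftrightarrow> legal_play E b ps \<and> untaken E ps = {}"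

definition maker_wins_play :: "'a rel \<Rightarrow> 'a round list \<Rightarrow> bool" where
  "maker_wins_play E ps \<longleftrightarrow>
     (\<exists>i j k. directed_triangle E i j k \<and> {(i, j), (j, k), (k, i)} \<subseteq> fst ` set ps)"

text \<open>A strategy for Breaker sees the completed rounds and Maker's edge in the current round.\<close>

type_synonym 'a breaker_strategy = "'a round list \<Rightarrow> 'a \<times> 'a \<Rightarrow> 'a rel"

definition legal_strategy :: "'a rel \<Rightarrow> nat \<Rightarrow> 'a breaker_strategy \<Rightarrow> bool" where
  "legal_strategy E b \<sigma> \<longleftrightarrow>
     (\<forall>ps e. legal_play E b ps \<and> e \<in> untaken E ps \<longrightarrow> breaker_move E b ps e (\<sigma> ps e))"

definition follows :: "'a breaker_strategy \<Rightarrow> 'a round list \<Rightarrow> bool" where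
  "follows \<sigma> ps \<longleftrightarrow> (\<forall>r<length ps. snd (ps ! r) = \<sigma> (take r ps) (fst (ps ! r)))"

definition breaker_has_winning_strategy :: "'a rel \<Rightarrow> nat \<Rightarrow> bool" where
  "breaker_has_winning_strategy E b \<longleftrightarrow>
     (\<exists>\<sigma>. legal_strategy E b \<sigma> \<and>
        (\<forall>ps. complete_play E b ps \<and> follows \<sigma> ps \<longrightarrow> \<not> maker_wins_play E ps))"

definition bias_threshold :: "nat \<Rightarrow> nat" where
  "bias_threshold n = (LEAST b. 0 < b \<and> breaker_has_winning_strategy (parity_tournament n) b)"

text \<open>The minimum exists: with a bias of at least the number of edges, Breaker ends the game in
  the first round.\<close>

lemma breaker_has_winning_strategy_large_bias:
  fixes E :: "'a rel"
  assumes "finite E" "card E \<le> b"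
  shows "breaker_has_winning_strategy E b"
proof -
  define \<sigma> :: "'a breaker_strategy" where "\<sigma> = (\<lambda>ps e. untaken E ps - {e})"
  have small: "card (untaken E ps - {e}) \<le> b" for ps e
    using assms card_mono[of E "untaken E ps - {e}"] by (force simp: untaken_def)
  have "legal_strategy E b \<sigma>"
    unfolding legal_strategy_def breaker_move_def \<sigma>_def
    by (simp only: min_absorb2[OF small] subset_refl simp_thms)
  moreover have "\<not> maker_wins_play E ps" if ps: "complete_play E b ps" "follows \<sigma> ps" for ps
  proof -
    have "length ps \<le> 1"
    proof (rule ccontr)
      assume "\<not> length ps \<le> 1"
      then obtain p q qs where [simp]: "ps = p # q # qs"
        by (cases ps; cases "tl ps") auto
      have "snd (ps ! 0) = \<sigma> (take 0 ps) (fst (ps ! 0))"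
        using ps(2) unfolding follows_def by (rule allE[of _ 0]) simp
      then have "snd p = E - {fst p}"
        by (simp add: \<sigma>_def untaken_def)
      then have "untaken E [p] = {}"
        by (cases p) (auto simp: untaken_def)
      moreover have "fst (ps ! 1) \<in> untaken E (take 1 ps)"
        using ps(1) \<open>\<not> length ps \<le> 1\<close> unfolding complete_play_def legal_play_def by (meson not_le)
      ultimately show False by simp
    qed
    then have x: "fst ` set ps \<subseteq> {fst (hd ps)}"
      by (cases ps) simp_all
    show ?thesis
    proof
      assume "maker_wins_play E ps"
      then obtain i j k where tri: "directed_triangle E i j k"
        "{(i, j), (j, k), (k, i)} \<subseteq> fst ` set ps"
        unfolding maker_wins_play_def by (elim exE conjE)
      have "{(i, j), (j, k), (k, i)} \<subseteq> {fst (hd ps)}"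
        using tri(2) x by (rule subset_trans)
      moreover have "i \<noteq> j"
        using tri(1) by (simp add: directed_triangle_def)
      ultimately show False by (cases "hd ps") simp
    qed
  qed
  ultimately show ?thesis
    unfolding breaker_has_winning_strategy_def by blast
qed

lemma bias_threshold_minimum:
  shows "0 < bias_threshold n"
    and "breaker_has_winning_strategy (parity_tournament n) (bias_threshold n)"
    and "0 < b \<Longrightarrow> breaker_has_winning_strategy (parity_tournament n) b \<Longrightarrow> bias_threshold n \<le> b"
proof -
  have "finite (parity_tournament n)"
    by (rule finite_subset[of _ "{1..n} \<times> {1..n}"]) (auto simp: parity_tournament_def)
  then have "0 < Suc (card (parity_tournament n)) \<and>
      breaker_has_winning_strategy (parity_tournament n) (Suc (card (parity_tournament n)))"
    by (simp add: breaker_has_winning_strategy_large_bias)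
  from LeastI[of "\<lambda>b. 0 < b \<and> breaker_has_winning_strategy (parity_tournament n) b", OF this]
  show "0 < bias_threshold n"
    and "breaker_has_winning_strategy (parity_tournament n) (bias_threshold n)"
    by (simp_all add: bias_threshold_def)
  show "0 < b \<Longrightarrow> breaker_has_winning_strategy (parity_tournament n) b \<Longrightarrow> bias_threshold n \<le> b"
    unfolding bias_threshold_def by (rule Least_le) simp
qed

end

theory Submission
  imports Defs "HOL-Real_Asymp.Real_Asymp"
begin

text \<open>Breaker, with bias \<open>2D\<close>, answers Maker's edge \<open>(u, v)\<close> by claiming \<open>D\<close> edges into \<open>u\<close> and
  \<open>D\<close> edges out of \<open>v\<close>, among them all edges that would now complete a triangle through
  \<open>(u, v)\<close>. The edges into \<open>u\<close> to be blocked are as many as Maker's edges out of \<open>v\<close>; each of the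
  latter cost \<open>v\<close> exactly \<open>D\<close> of its incoming edges, and \<open>(u, v)\<close> was still free, so there are fewer
  than \<open>D\<close> of them if \<open>D\<^sup>2\<close> is at least the maximal indegree. Symmetrically for the
  edges out of \<open>v\<close>. As in- and outdegrees in the parity tournament are about \<open>n/2\<close>, a bias of about
  \<open>\<surd>(2n)\<close> suffices.

  Maker fixes \<open>v = 1\<close>, a set \<open>W\<close> of about \<open>n/4\<close> small even numbers and a set \<open>Z\<close> of about \<open>n/4\<close>
  large odd numbers, so that all edges run from \<open>v\<close> to \<open>W\<close>, from \<open>W\<close> to \<open>Z\<close> and from \<open>Z\<close> to \<open>v\<close>.
  She first takes \<open>b + 1\<close> edges from \<open>Z\<close> to \<open>v\<close>. If \<open>b (b + 1) < |W|\<close>, some \<open>w \<in> W\<close> is then untouched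
  by Breaker, and \<open>(v, w)\<close> creates \<open>b + 1\<close> simultaneous threats.\<close>

section \<open>Plays\<close>

lemma legal_play_snoc:
  "legal_play E b (ps @ [x]) \<longleftrightarrow>
     legal_play E b ps \<and> fst x \<in> untaken E ps \<and> breaker_move E b ps (fst x) (snd x)"
  unfolding legal_play_def by (auto simp: nth_append less_Suc_eq)

lemma follows_snoc:
  "follows \<sigma> (ps @ [x]) \<longleftrightarrow> follows \<sigma> ps \<and> snd x = \<sigma> ps (fst x)"
  unfolding follows_def by (auto simp: nth_append less_Suc_eq)

lemma untaken_eq: "untaken E ps = E - (fst ` set ps \<union> \<Union>(snd ` set ps))"
  unfolding untaken_def by (auto simp: case_prod_beta)

lemma untaken_snoc: "untaken E (ps @ [x]) = untaken E ps - insert (fst x) (snd x)"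
  unfolding untaken_eq by auto

lemma untaken_antimono: "set ps \<subseteq> set qs \<Longrightarrow> untaken E qs \<subseteq> untaken E ps"
  unfolding untaken_def by blast

lemma taken_in_round:
  assumes "r < length ps"
  shows "insert (fst (ps ! r)) (snd (ps ! r)) \<inter> untaken E ps = {}"
  using nth_mem[OF assms] unfolding untaken_eq by blast

lemma taken_in_earlier_round:
  assumes "r < s" "s \<le> length ps"
  shows "insert (fst (ps ! r)) (snd (ps ! r)) \<inter> untaken E (take s ps) = {}"
  using taken_in_round[of r "take s ps" E] assms by simp

lemma legal_play_claims:
  assumes "legal_play E b ps" "r < length ps"
  shows "fst (ps ! r) \<in> untaken E (take r ps)" "snd (ps ! r) \<subseteq> untaken E (take r ps)"
  using assms unfolding legal_play_def breaker_move_def by blast+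

lemma finite_untaken: "finite E \<Longrightarrow> finite (untaken E ps)"
  by (simp add: untaken_def)

section \<open>Breaker's strategy\<close>

text \<open>\<open>S\<close> stands for a star of free edges to be depleted, \<open>B\<close> for
  the threats in it. Each clause has an escape, \<open>S\<close> exhausted or \<open>B\<close> too
  large, so that a covering set always exists; that the threats are few is argued later from the
  history of the play.\<close>

definition covers :: "nat \<Rightarrow> 'a set \<Rightarrow> 'a set \<Rightarrow> 'a set \<Rightarrow> bool" where
  "covers D S B F \<longleftrightarrow> (D \<le> card (F \<inter> S) \<or> S \<subseteq> F) \<and> (card B \<le> D \<longrightarrow> B \<subseteq> F)"

lemma covers_mono:
  assumes "covers D S B F" "F \<subseteq> G" "finite G"
  shows "covers D S B G"
proof -
  have "card (F \<inter> S) \<le> card (G \<inter> S)"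
    using assms by (intro card_mono) auto
  with assms show ?thesis
    unfolding covers_def by (meson order_trans)
qed

lemma covers_exists:
  assumes "finite S" "B \<subseteq> S"
  obtains F where "F \<subseteq> S" "card F \<le> D" "covers D S B F"
proof -
  \<comment> \<open>With more than \<open>D\<close> threats the second clause of
    \<open>covers\<close> is vacuous, so nothing has to be forced into \<open>F\<close>.\<close>
  define B' where "B' = (if card B \<le> D then B else {})"
  have "card B' \<le> min D (card S)"
    using assms by (simp add: B'_def card_mono)
  then obtain F where F: "B' \<subseteq> F" "F \<subseteq> S" "card F = min D (card S)"
    using exists_subset_between[of B' "min D (card S)" S] assms
    by (metis B'_def empty_subsetI min.cobounded2)
  have "D \<le> card F \<or> F = S"
    using F assms(1) card_subset_eq[of S F] by linarith
  then have "covers D S B F"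
    using F unfolding covers_def B'_def by (auto simp: inf_absorb1)
  then show ?thesis
    using F that by simp
qed

text \<open>Two covering sets have at most \<open>2 * D\<close> elements together, and covering
  survives enlargement, so their union can be padded inside \<open>U\<close> to the exact size of a
  legal move.\<close>

lemma covers_both_exists:
  assumes "finite U" "S \<subseteq> U" "S' \<subseteq> U" "B \<subseteq> S" "B' \<subseteq> S'"
  obtains F where "F \<subseteq> U" "card F = min (2 * D) (card U)" "covers D S B F" "covers D S' B' F"
proof -
  have fin: "finite S" "finite S'"
    using assms finite_subset by blast+
  obtain F1 where F1: "F1 \<subseteq> S" "card F1 \<le> D" "covers D S B F1"
    using covers_exists fin(1) assms(4) .
  obtain F2 where F2: "F2 \<subseteq> S'" "card F2 \<le> D" "covers D S' B' F2"
    using covers_exists fin(2) assms(5) .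
  have sub: "F1 \<union> F2 \<subseteq> U"
    using F1 F2 assms by blast
  have "card (F1 \<union> F2) \<le> min (2 * D) (card U)"
    using card_Un_le[of F1 F2] F1 F2 card_mono[OF assms(1) sub] by simp
  then obtain F where F: "F1 \<union> F2 \<subseteq> F" "F \<subseteq> U" "card F = min (2 * D) (card U)"
    using exists_subset_between[of "F1 \<union> F2" "min (2 * D) (card U)" U] sub assms(1) by auto
  have "finite F"
    using F(2) assms(1) finite_subset by blast
  then have "covers D S B F" "covers D S' B' F"
    using covers_mono F1(3) F2(3) F(1) by blast+
  with F that show ?thesis by blast
qed

text \<open>For \<open>e = (u, v)\<close>, the first star is that of the free edges into
  \<open>u\<close>, with threats \<open>(w, u)\<close> where Maker owns \<open>(v, w)\<close>; the
  second is that of the free edges out of \<open>v\<close>, with threats \<open>(v, w)\<close> where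
  Maker owns \<open>(w, u)\<close>.\<close>

definition response :: "'a rel \<Rightarrow> nat \<Rightarrow> 'a round list \<Rightarrow> 'a \<times> 'a \<Rightarrow> 'a rel \<Rightarrow> bool" where
  "response E D ps e F \<longleftrightarrow> breaker_move E (2 * D) ps e F \<and>
     covers D {f \<in> untaken E ps - {e}. snd f = fst e}
       {f \<in> untaken E ps - {e}. snd f = fst e \<and> (snd e, fst f) \<in> fst ` set ps} F \<and>
     covers D {f \<in> untaken E ps - {e}. fst f = snd e}
       {f \<in> untaken E ps - {e}. fst f = snd e \<and> (snd f, fst e) \<in> fst ` set ps} F"

lemma response_exists:
  assumes "finite E"
  shows "\<exists>F. response E D ps e F"
proof -
  let ?U = "untaken E ps - {e}"
  obtain F where "F \<subseteq> ?U" "card F = min (2 * D) (card ?U)"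
    "covers D {f \<in> ?U. snd f = fst e}
       {f \<in> ?U. snd f = fst e \<and> (snd e, fst f) \<in> fst ` set ps} F"
    "covers D {f \<in> ?U. fst f = snd e}
       {f \<in> ?U. fst f = snd e \<and> (snd f, fst e) \<in> fst ` set ps} F"
    by (rule covers_both_exists[of ?U "{f \<in> ?U. snd f = fst e}" "{f \<in> ?U. fst f = snd e}"
          "{f \<in> ?U. snd f = fst e \<and> (snd e, fst f) \<in> fst ` set ps}"
          "{f \<in> ?U. fst f = snd e \<and> (snd f, fst e) \<in> fst ` set ps}" D])
      (use finite_untaken[OF assms] in auto)
  then show ?thesis
    unfolding response_def breaker_move_def by blast
qed

text \<open>Breaker's sets from different rounds are disjoint and all miss the free edge
  \<open>f\<close>, so the rounds in \<open>R\<close> use up \<open>card R * D\<close> edges of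
  \<open>S - {f}\<close>. If \<open>card S \<le> D * D\<close>, this forces
  \<open>card R < D\<close>.\<close>

lemma few_expensive_rounds:
  assumes legal: "legal_play E b ps" and "finite S" and f: "f \<in> S" "f \<in> untaken E ps"
    and R: "\<And>r. r \<in> R \<Longrightarrow> r < length ps \<and> D \<le> card (snd (ps ! r) \<inter> S)"
  shows "card R * D < card S"
proof -
  have "finite R"
    using R by (intro finite_subset[of R "{..<length ps}"]) auto
  have disj: "snd (ps ! r) \<inter> snd (ps ! s) = {}" if "r < s" "s < length ps" for r s
    using taken_in_earlier_round[of r s ps E] legal_play_claims[OF legal, of s] that by auto
  have "card R * D \<le> (\<Sum>r\<in>R. card (snd (ps ! r) \<inter> S))"
    using sum_bounded_below[of R D "\<lambda>r. card (snd (ps ! r) \<inter> S)"] R by simp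
  also have "\<dots> = card (\<Union>r\<in>R. snd (ps ! r) \<inter> S)"
  proof (rule card_UN_disjoint[symmetric])
    show "\<forall>r\<in>R. \<forall>s\<in>R. r \<noteq> s \<longrightarrow> (snd (ps ! r) \<inter> S) \<inter> (snd (ps ! s) \<inter> S) = {}"
    proof (intro ballI impI)
      fix r s assume "r \<in> R" "s \<in> R" "r \<noteq> s"
      then have "snd (ps ! r) \<inter> snd (ps ! s) = {}"
        using disj[of r s] disj[of s r] R by (metis Int_commute nat_neq_iff)
      then show "(snd (ps ! r) \<inter> S) \<inter> (snd (ps ! s) \<inter> S) = {}" by blast
    qed
  qed (use \<open>finite R\<close> \<open>finite S\<close> in auto)
  also have "\<dots> \<le> card (S - {f})"
    using taken_in_round[of _ ps E] R f \<open>finite S\<close> by (intro card_mono) auto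
  also have "\<dots> < card S"
    using \<open>finite S\<close> f(1) by (rule card_Diff1_less)
  finally show ?thesis .
qed

text \<open>Consider the second edge that Maker claims of a supposed triangle. At that moment the
  third edge is one of fewer than \<open>D\<close> threats, so Breaker's response takes it.\<close>

lemma breaker_wins_if_degrees_bounded:
  fixes E :: "'a rel"
  assumes fin: "finite E"
    and indeg: "\<And>v. card {f \<in> E. snd f = v} \<le> D * D"
    and outdeg: "\<And>v. card {f \<in> E. fst f = v} \<le> D * D"
  shows "breaker_has_winning_strategy E (2 * D)"
proof -
  define \<sigma> :: "'a breaker_strategy" where "\<sigma> = (\<lambda>ps e. SOME F. response E D ps e F)"
  have \<sigma>: "response E D ps e (\<sigma> ps e)" for ps e
    unfolding \<sigma>_def using response_exists[OF fin] by (rule someI_ex)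
  have "legal_strategy E (2 * D) \<sigma>"
    using \<sigma> unfolding legal_strategy_def response_def by blast
  moreover have "\<not> maker_wins_play E ps"
    if ps: "complete_play E (2 * D) ps" "follows \<sigma> ps" for ps
  proof
    have legal: "legal_play E (2 * D) ps"
      using ps(1) by (simp add: complete_play_def)
    have legal_take: "legal_play E (2 * D) (take r ps)" if "r < length ps" for r
      using legal that unfolding legal_play_def by (simp add: min_def)
    have resp: "response E D (take r ps) (fst (ps ! r)) (snd (ps ! r))" if "r < length ps" for r
      using ps(2) \<sigma> that unfolding follows_def by simp
    note free = legal_play_claims(1)[OF legal]
    note gone = taken_in_earlier_round[of _ _ ps E]
    have in_E: "untaken E qs \<subseteq> E" for qs
      unfolding untaken_def by blast
    have A: False
      if "s < r" "r < t" "t < length ps"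
        and e: "fst (ps ! s) = (v, w)" "fst (ps ! r) = (u, v)" "fst (ps ! t) = (w, u)"
      for r s t u v w
    proof -
      \<comment> \<open>Breaker answered each Maker edge out of \<open>v\<close> by claiming edges
        into \<open>v\<close>, so the rounds in \<open>R\<close> are charged to the indegree of
        \<open>v\<close>.\<close>
      define R where "R = {i. i < r \<and> fst (fst (ps ! i)) = v}"
      let ?B = "{f \<in> untaken E (take r ps) - {(u, v)}. snd f = u \<and>
        (v, fst f) \<in> fst ` set (take r ps)}"
      have uv: "(u, v) \<in> untaken E (take r ps)"
        using free[of r] that by simp
      have expensive: "D \<le> card (snd (ps ! i) \<inter> {f \<in> E. snd f = v})" if "i \<in> R" for i
      proof -
        let ?S = "{f \<in> untaken E (take i ps) - {fst (ps ! i)}. snd f = v}"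
        have i: "i < r" "fst (fst (ps ! i)) = v"
          using that by (auto simp: R_def)
        have "(u, v) \<notin> snd (ps ! i)" "(u, v) \<noteq> fst (ps ! i)"
          using gone[of i r] i \<open>r < t\<close> \<open>t < length ps\<close> uv by auto
        moreover have "(u, v) \<in> untaken E (take i ps)"
          using uv untaken_antimono[OF set_take_subset_set_take[of i r ps]] i by auto
        \<comment> \<open>Since \<open>(u, v)\<close> survived round \<open>i\<close>, Breaker did
          not exhaust the star at \<open>v\<close> and must have claimed \<open>D\<close> of its
          edges.\<close>
        ultimately have "\<not> ?S \<subseteq> snd (ps ! i)" by auto
        then have "D \<le> card (snd (ps ! i) \<inter> ?S)"
          using resp[of i] i \<open>r < t\<close> \<open>t < length ps\<close> unfolding response_def covers_def by auto
        also have "\<dots> \<le> card (snd (ps ! i) \<inter> {f \<in> E. snd f = v})"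
          using fin in_E[of "take i ps"] by (intro card_mono) auto
        finally show ?thesis .
      qed
      have "card R * D < card {f \<in> E. snd f = v}"
        by (rule few_expensive_rounds[OF legal_take[of r], where f = "(u, v)"])
          (use expensive fin uv in_E[of "take r ps"] that in \<open>auto simp: R_def\<close>)
      then have "card R < D"
        using indeg[of v] by (meson less_le_trans mult_less_cancel2)
      \<comment> \<open>Every threat \<open>(x, u)\<close> stems from a Maker edge
        \<open>(v, x)\<close> of a round in \<open>R\<close>, so there are at most
        \<open>card R\<close> threats.\<close>
      moreover have "?B \<subseteq> (\<lambda>i. (snd (fst (ps ! i)), u)) ` R"
      proof
        fix f assume f: "f \<in> ?B"
        then obtain i where "i < length (take r ps)" "(v, fst f) = fst (take r ps ! i)"
          by (auto simp: in_set_conv_nth)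
        then have "i \<in> R" "snd (fst (ps ! i)) = fst f"
          by (auto simp: R_def) (metis fst_conv, metis snd_conv)
        with f show "f \<in> (\<lambda>i. (snd (fst (ps ! i)), u)) ` R"
          by (intro image_eqI[of _ _ i]) (auto simp: prod_eq_iff)
      qed
      moreover have "finite R"
        by (simp add: R_def)
      ultimately have "card ?B \<le> D"
        by (meson order_trans surj_card_le less_imp_le)
      then have "?B \<subseteq> snd (ps ! r)"
        using resp[of r] that unfolding response_def covers_def by auto
      moreover have "(w, u) \<in> ?B"
      proof -
        have "(w, u) \<in> untaken E (take r ps)"
          using free[of t] that untaken_antimono[OF set_take_subset_set_take[of r t ps]] by auto
        moreover have "(w, u) \<noteq> (u, v)"
          using free[of t] gone[of r t] that by auto
        moreover have "(v, w) \<in> fst ` set (take r ps)"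
          using e(1) that by (force simp: in_set_conv_nth image_iff intro!: exI[of _ s])
        ultimately show ?thesis by auto
      qed
      ultimately have "(w, u) \<in> snd (ps ! r)" by blast
      with free[of t] gone[of r t] that show False by auto
    qed
    \<comment> \<open>The mirror image of \<open>A\<close> with all arrows reversed: Maker's earlier
      edges into \<open>u\<close> are charged to the outdegree of \<open>u\<close>.\<close>
    have B: False
      if "s < r" "r < t" "t < length ps"
        and e: "fst (ps ! s) = (w, u)" "fst (ps ! r) = (u, v)" "fst (ps ! t) = (v, w)"
      for r s t u v w
    proof -
      define R where "R = {i. i < r \<and> snd (fst (ps ! i)) = u}"
      let ?B = "{f \<in> untaken E (take r ps) - {(u, v)}. fst f = v \<and>
        (snd f, u) \<in> fst ` set (take r ps)}"
      have uv: "(u, v) \<in> untaken E (take r ps)"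
        using free[of r] that by simp
      have expensive: "D \<le> card (snd (ps ! i) \<inter> {f \<in> E. fst f = u})" if "i \<in> R" for i
      proof -
        let ?S = "{f \<in> untaken E (take i ps) - {fst (ps ! i)}. fst f = u}"
        have i: "i < r" "snd (fst (ps ! i)) = u"
          using that by (auto simp: R_def)
        have "(u, v) \<notin> snd (ps ! i)" "(u, v) \<noteq> fst (ps ! i)"
          using gone[of i r] i \<open>r < t\<close> \<open>t < length ps\<close> uv by auto
        moreover have "(u, v) \<in> untaken E (take i ps)"
          using uv untaken_antimono[OF set_take_subset_set_take[of i r ps]] i by auto
        ultimately have "\<not> ?S \<subseteq> snd (ps ! i)" by auto
        then have "D \<le> card (snd (ps ! i) \<inter> ?S)"
          using resp[of i] i \<open>r < t\<close> \<open>t < length ps\<close> unfolding response_def covers_def by auto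
        also have "\<dots> \<le> card (snd (ps ! i) \<inter> {f \<in> E. fst f = u})"
          using fin in_E[of "take i ps"] by (intro card_mono) auto
        finally show ?thesis .
      qed
      have "card R * D < card {f \<in> E. fst f = u}"
        by (rule few_expensive_rounds[OF legal_take[of r], where f = "(u, v)"])
          (use expensive fin uv in_E[of "take r ps"] that in \<open>auto simp: R_def\<close>)
      then have "card R < D"
        using outdeg[of u] by (meson less_le_trans mult_less_cancel2)
      moreover have "?B \<subseteq> (\<lambda>i. (v, fst (fst (ps ! i)))) ` R"
      proof
        fix f assume f: "f \<in> ?B"
        then obtain i where "i < length (take r ps)" "(snd f, u) = fst (take r ps ! i)"
          by (auto simp: in_set_conv_nth)
        then have "i \<in> R" "fst (fst (ps ! i)) = snd f"
          by (auto simp: R_def) (metis snd_conv, metis fst_conv)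
        with f show "f \<in> (\<lambda>i. (v, fst (fst (ps ! i)))) ` R"
          by (intro image_eqI[of _ _ i]) (auto simp: prod_eq_iff)
      qed
      moreover have "finite R"
        by (simp add: R_def)
      ultimately have "card ?B \<le> D"
        by (meson order_trans surj_card_le less_imp_le)
      then have "?B \<subseteq> snd (ps ! r)"
        using resp[of r] that unfolding response_def covers_def by auto
      moreover have "(v, w) \<in> ?B"
      proof -
        have "(v, w) \<in> untaken E (take r ps)"
          using free[of t] that untaken_antimono[OF set_take_subset_set_take[of r t ps]] by auto
        moreover have "(v, w) \<noteq> (u, v)"
          using free[of t] gone[of r t] that by auto
        moreover have "(w, u) \<in> fst ` set (take r ps)"
          using e(1) that by (force simp: in_set_conv_nth image_iff intro!: exI[of _ s])
        ultimately show ?thesis by auto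
      qed
      ultimately have "(v, w) \<in> snd (ps ! r)" by blast
      with free[of t] gone[of r t] that show False by auto
    qed
    assume "maker_wins_play E ps"
    then obtain i j k where ijk: "i \<noteq> j" "j \<noteq> k" "i \<noteq> k"
      "{(i, j), (j, k), (k, i)} \<subseteq> fst ` set ps"
      unfolding maker_wins_play_def directed_triangle_def by blast
    then obtain x y z where xyz: "x < length ps" "y < length ps" "z < length ps"
      "fst (ps ! x) = (i, j)" "fst (ps ! y) = (j, k)" "fst (ps ! z) = (k, i)"
      by (auto simp: in_set_conv_nth)
    with ijk have "x \<noteq> y" "y \<noteq> z" "x \<noteq> z" by auto
    \<comment> \<open>Of the six orders, the three that follow the direction of the triangle are
      instances of \<open>B\<close>, the other three of \<open>A\<close>.\<close>
    then consider "x < y" "y < z" | "x < z" "z < y" | "y < x" "x < z" | "y < z" "z < x"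
      | "z < x" "x < y" | "z < y" "y < x"
      by linarith
    then show False
      by cases (use A B xyz in blast)+
  qed
  ultimately show ?thesis
    unfolding breaker_has_winning_strategy_def by blast
qed

section \<open>Maker's strategy\<close>

lemma play_step:
  assumes "legal_strategy E b \<sigma>" "legal_play E b ps" "follows \<sigma> ps" "e \<in> untaken E ps"
  shows "legal_play E b (ps @ [(e, \<sigma> ps e)])" "follows \<sigma> (ps @ [(e, \<sigma> ps e)])"
proof -
  have "breaker_move E b ps e (\<sigma> ps e)"
    using assms unfolding legal_strategy_def by blast
  then show "legal_play E b (ps @ [(e, \<sigma> ps e)])" "follows \<sigma> (ps @ [(e, \<sigma> ps e)])"
    using assms by (simp_all add: legal_play_snoc follows_snoc)
qed

text \<open>Winning is judged on complete plays only, so a play in which Maker already owns a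
  triangle has to be continued; her further edges are arbitrary.\<close>

lemma extends_to_complete_play:
  assumes "finite E" "legal_strategy E b \<sigma>" "legal_play E b ps" "follows \<sigma> ps"
  shows "\<exists>qs. complete_play E b qs \<and> follows \<sigma> qs \<and> set ps \<subseteq> set qs"
  using assms(3,4)
proof (induction "card (untaken E ps)" arbitrary: ps rule: less_induct)
  case less
  show ?case
  proof (cases "untaken E ps = {}")
    case True
    then show ?thesis
      using less.prems unfolding complete_play_def by blast
  next
    case False
    then obtain e where e: "e \<in> untaken E ps" by blast
    let ?qs = "ps @ [(e, \<sigma> ps e)]"
    have "untaken E ?qs \<subset> untaken E ps"
      using e by (auto simp: untaken_snoc)
    then have "card (untaken E ?qs) < card (untaken E ps)"
      by (simp add: psubset_card_mono finite_untaken assms(1))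
    moreover have "legal_play E b ?qs" "follows \<sigma> ?qs"
      using less.prems e assms(2) by (simp_all add: play_step)
    ultimately show ?thesis
      using less.hyps[of ?qs] by auto
  qed
qed

lemma card_breaker_edges:
  assumes "finite E" "legal_play E b ps"
  shows "finite (\<Union>(snd ` set ps)) \<and> card (\<Union>(snd ` set ps)) \<le> length ps * b"
  using assms(2)
proof (induction ps rule: rev_induct)
  case (snoc x ps)
  have F: "snd x \<subseteq> untaken E ps" "card (snd x) \<le> b"
    using snoc.prems by (auto simp: legal_play_snoc breaker_move_def)
  then have "finite (snd x)"
    using finite_untaken[OF assms(1)] finite_subset by blast
  moreover have "card (snd x \<union> \<Union>(snd ` set ps)) \<le> b + length ps * b"
    using card_Un_le[of "snd x" "\<Union>(snd ` set ps)"] F snoc by (simp add: legal_play_snoc)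
  ultimately show ?case
    using snoc by (simp add: legal_play_snoc)
qed simp

text \<open>In \<open>b + 1\<close> rounds Breaker claims at most \<open>b * (b + 1)\<close> edges,
  too few to spoil every vertex of \<open>W\<close>. The bound on \<open>card Z\<close> keeps a
  fresh vertex available while Maker builds her star at \<open>v\<close>.\<close>

lemma maker_wins_if_tripartite:
  assumes fin: "finite E"
    and sub: "{v} \<times> W \<subseteq> E" "W \<times> Z \<subseteq> E" "Z \<times> {v} \<subseteq> E"
    and disj: "v \<notin> W" "v \<notin> Z" "W \<inter> Z = {}"
    and card: "b * (b + 1) < card W" "b * (b + 1) < card Z"
  shows "\<not> breaker_has_winning_strategy E b"
proof
  assume "breaker_has_winning_strategy E b"
  then obtain \<sigma> where \<sigma>: "legal_strategy E b \<sigma>"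
    and wins: "\<And>ps. complete_play E b ps \<Longrightarrow> follows \<sigma> ps \<Longrightarrow> \<not> maker_wins_play E ps"
    unfolding breaker_has_winning_strategy_def by blast
  have finWZ: "finite W" "finite Z"
    using card by (auto intro: card_ge_0_finite)
  have step: "legal_play E b (ps @ [(e, \<sigma> ps e)]) \<and> follows \<sigma> (ps @ [(e, \<sigma> ps e)])"
    if "legal_play E b ps" "follows \<sigma> ps" "e \<in> untaken E ps" for ps e
    using that \<sigma> by (simp add: play_step)
  have star: "\<exists>ps Y. legal_play E b ps \<and> follows \<sigma> ps \<and> length ps = k \<and>
      Y \<subseteq> Z \<and> card Y = k \<and> fst ` set ps = Y \<times> {v}" if "k \<le> b + 1" for k
    using that
  proof (induction k)
    case 0
    show ?case
      by (intro exI[of _ "[]"] exI[of _ "{}"]) (simp add: legal_play_def follows_def)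
  next
    case (Suc k)
    then obtain ps Y where ps: "legal_play E b ps" "follows \<sigma> ps" "length ps = k"
      "Y \<subseteq> Z" "card Y = k" "fst ` set ps = Y \<times> {v}"
      by auto
    let ?U = "\<Union>(snd ` set ps)"
    have fY: "finite Y"
      using ps(4) finWZ(2) finite_subset by blast
    have U: "finite ?U" "card ?U \<le> k * b"
      using card_breaker_edges[OF fin ps(1)] ps(3) by auto
    \<comment> \<open>Here \<open>k \<le> b\<close>, so the used vertices and the tails of Breaker's
      edges number at most \<open>k * (b + 1)\<close>, still below \<open>card Z\<close>.\<close>
    have "card (Y \<union> fst ` ?U) \<le> k + k * b"
      using card_Un_le[of Y "fst ` ?U"] card_image_le[OF U(1), of fst] U(2) ps(5) by linarith
    also have "\<dots> \<le> b * (b + 1)"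
      using Suc.prems mult_le_mono1[of k b "b + 1"] by simp
    finally have "\<not> Z \<subseteq> Y \<union> fst ` ?U"
      using card(2) card_mono[of "Y \<union> fst ` ?U" Z] fY U(1) by auto
    then obtain z where z: "z \<in> Z" "z \<notin> Y" "z \<notin> fst ` ?U" by blast
    then have "(z, v) \<notin> ?U" by force
    then have "(z, v) \<in> untaken E ps"
      using z ps(6) sub(3) by (auto simp: untaken_eq)
    from step[OF ps(1,2) this] show ?case
      by (intro exI[of _ "ps @ [((z, v), \<sigma> ps (z, v))]"] exI[of _ "insert z Y"])
        (use ps z fY in auto)
  qed
  obtain ps Y where ps: "legal_play E b ps" "follows \<sigma> ps" "length ps = b + 1"
    "Y \<subseteq> Z" "card Y = b + 1" "fst ` set ps = Y \<times> {v}"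
    using star[of "b + 1"] by auto
  let ?U = "\<Union>(snd ` set ps)"
  \<comment> \<open>\<open>?h\<close> sends both \<open>(v, w)\<close> and every
    \<open>(w, z)\<close> to \<open>w\<close>, so each Breaker edge spoils at most one vertex of
    \<open>W\<close>.\<close>
  let ?h = "\<lambda>(x, y). if x = v then y else x"
  have U: "finite ?U" "card ?U \<le> (b + 1) * b"
    using card_breaker_edges[OF fin ps(1)] ps(3) by auto
  have "card (?h ` ?U) < card W"
    using card_image_le[OF U(1), of ?h] U(2) card(1) by (simp add: mult.commute)
  then have "\<not> W \<subseteq> ?h ` ?U"
    using card_mono[of "?h ` ?U" W] U(1) by auto
  then obtain w where w: "w \<in> W" "w \<notin> ?h ` ?U" by blast
  have "(v, w) \<notin> ?U"
    using w(2) by force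
  then have vw: "(v, w) \<in> untaken E ps"
    using w(1) ps(4,6) sub(1) disj by (auto simp: untaken_eq)
  define F where "F = \<sigma> ps (v, w)"
  define qs where "qs = ps @ [((v, w), F)]"
  have qs: "legal_play E b qs" "follows \<sigma> qs"
    using step[OF ps(1,2) vw] by (simp_all add: qs_def F_def)
  have F: "finite F" "card F \<le> b"
    using qs(1) finite_subset[of F] finite_untaken[OF fin]
    by (auto simp: qs_def legal_play_snoc breaker_move_def intro: finite_subset)
  \<comment> \<open>Maker threatens \<open>b + 1\<close> edges from \<open>w\<close> to
    \<open>Y\<close>, one more than Breaker's reply \<open>F\<close> can hit.\<close>
  have "\<not> Y \<subseteq> snd ` F"
    using card_mono[of "snd ` F" Y] card_image_le[OF F(1), of snd] F ps(5) by auto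
  then obtain z where z: "z \<in> Y" "z \<notin> snd ` F" by blast
  have "z \<in> Z" "w \<noteq> v"
    using z ps(4) w disj by auto
  have "(w, z) \<notin> ?U"
    using w(2) \<open>w \<noteq> v\<close> by force
  moreover have "(w, z) \<notin> F"
    using z(2) by force
  ultimately have wz: "(w, z) \<in> untaken E qs"
    using w(1) \<open>z \<in> Z\<close> \<open>w \<noteq> v\<close> ps(4,6) sub(2) disj by (auto simp: untaken_eq qs_def)
  obtain rs where rs: "complete_play E b rs" "follows \<sigma> rs"
    "set (qs @ [((w, z), \<sigma> qs (w, z))]) \<subseteq> set rs"
    using extends_to_complete_play[OF fin \<sigma>] step[OF qs wz] by blast
  have "(z, v) \<in> fst ` set ps"
    using ps(6) z(1) by simp
  then have "{(v, w), (w, z), (z, v)} \<subseteq> fst ` set (qs @ [((w, z), \<sigma> qs (w, z))])"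
    by (simp add: qs_def)
  also have "\<dots> \<subseteq> fst ` set rs"
    using rs(3) by (rule image_mono)
  finally have "{(v, w), (w, z), (z, v)} \<subseteq> fst ` set rs" .
  moreover have "directed_triangle E v w z"
    using w(1) \<open>z \<in> Z\<close> sub disj unfolding directed_triangle_def by auto
  ultimately have "maker_wins_play E rs"
    unfolding maker_wins_play_def by blast
  with wins rs(1,2) show False by blast
qed

section \<open>The parity tournament\<close>

lemma finite_parity_tournament: "finite (parity_tournament n)"
  by (rule finite_subset[of _ "{1..n} \<times> {1..n}"]) (auto simp: parity_tournament_def)

text \<open>The \<open>n div 2 + 1\<close> pairs \<open>{2 * i, 2 * i + 1}\<close> cover
  \<open>{..n}\<close>, and \<open>S\<close> meets each at most once.\<close>

lemma card_le_if_inj_half: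
  fixes S :: "nat set"
  assumes "S \<subseteq> {..n}" and "\<And>i. \<not> (2 * i \<in> S \<and> Suc (2 * i) \<in> S)"
  shows "card S \<le> n div 2 + 1"
proof -
  have "inj_on (\<lambda>i. i div 2) S"
  proof (rule inj_onI)
    fix i j assume ij: "i \<in> S" "j \<in> S" "i div 2 = j div 2"
    show "i = j"
      using assms(2)[of "i div 2"] ij
      by (cases "even i"; cases "even j") (auto elim!: evenE oddE)
  qed
  moreover have "(\<lambda>i. i div 2) ` S \<subseteq> {..n div 2}"
    using assms(1) by (auto intro: div_le_mono)
  ultimately have "card S \<le> card {..n div 2}"
    by (intro card_inj_on_le) auto
  then show ?thesis by simp
qed

lemma parity_tournament_indegree:
  "card {f \<in> parity_tournament n. snd f = v} \<le> n div 2 + 1"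
proof -
  let ?S = "{i. (i, v) \<in> parity_tournament n}"
  have "{f \<in> parity_tournament n. snd f = v} = (\<lambda>i. (i, v)) ` ?S" by force
  then have "card {f \<in> parity_tournament n. snd f = v} = card ?S"
    by (simp add: card_image inj_on_def)
  also have "\<dots> \<le> n div 2 + 1"
  proof (rule card_le_if_inj_half)
    \<comment> \<open>If neither number is \<open>v\<close>, both lie on the same side of
      \<open>v\<close> and differ in parity, so their edges at \<open>v\<close> point in opposite
      directions; \<open>v\<close> itself has no loop.\<close>
    show "\<not> (2 * i \<in> ?S \<and> Suc (2 * i) \<in> ?S)" for i
      unfolding parity_tournament_def by (simp, presburger)
  qed (auto simp: parity_tournament_def)
  finally show ?thesis .
qed

lemma parity_tournament_outdegree:
  "card {f \<in> parity_tournament n. fst f = v} \<le> n div 2 + 1"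
proof -
  let ?S = "{i. (v, i) \<in> parity_tournament n}"
  have "{f \<in> parity_tournament n. fst f = v} = (\<lambda>i. (v, i)) ` ?S" by force
  then have "card {f \<in> parity_tournament n. fst f = v} = card ?S"
    by (simp add: card_image inj_on_def)
  also have "\<dots> \<le> n div 2 + 1"
  proof (rule card_le_if_inj_half)
    show "\<not> (2 * i \<in> ?S \<and> Suc (2 * i) \<in> ?S)" for i
      unfolding parity_tournament_def by (simp, presburger)
  qed (auto simp: parity_tournament_def)
  finally show ?thesis .
qed

lemma bias_threshold_upper:
  "real (bias_threshold n) \<le> 2 * (sqrt (real n / 2 + 1) + 1)"
proof -
  \<comment> \<open>The least \<open>D\<close> with \<open>D * D\<close> at least
    \<open>n / 2 + 1\<close>, which dominates both degree bounds.\<close>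
  define D where "D = nat \<lceil>sqrt (real n / 2 + 1)\<rceil>"
  have D: "sqrt (real n / 2 + 1) \<le> real D" "real D \<le> sqrt (real n / 2 + 1) + 1"
    unfolding D_def by (simp_all add: of_nat_ceiling)
  have "real n / 2 + 1 \<le> (real D)\<^sup>2"
    using D(1) by (rule sqrt_le_D)
  moreover have "real (n div 2 + 1) \<le> real n / 2 + 1" by linarith
  ultimately have "real (n div 2 + 1) \<le> real (D * D)"
    by (simp add: power2_eq_square)
  then have deg: "n div 2 + 1 \<le> D * D"
    by (simp only: of_nat_le_iff)
  then have "0 < 2 * D"
    by (cases D) auto
  moreover have "breaker_has_winning_strategy (parity_tournament n) (2 * D)"
    using deg parity_tournament_indegree[of n] parity_tournament_outdegree[of n]
    by (intro breaker_wins_if_degrees_bounded finite_parity_tournament) (meson order_trans)+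
  ultimately have "bias_threshold n \<le> 2 * D"
    by (rule bias_threshold_minimum(3))
  then have "real (bias_threshold n) \<le> real (2 * D)"
    by (simp only: of_nat_le_iff)
  with D(2) show ?thesis by simp
qed

lemma bias_threshold_lower:
  "(n - 1) div 4 \<le> bias_threshold n * (bias_threshold n + 1)"
proof (rule ccontr)
  define m where "m = (n - 1) div 4"
  \<comment> \<open>\<open>W\<close> holds the even numbers from 2 to \<open>2 * m\<close>,
    \<open>Z\<close> the odd numbers from \<open>2 * m + 3\<close> to
    \<open>4 * m + 1\<close>.\<close>
  define W where "W = (\<lambda>i. 2 * i) ` {1..m}"
  define Z where "Z = (\<lambda>i. 2 * m + 2 * i + 1) ` {1..m}"
  assume "\<not> ?thesis"
  then have b: "bias_threshold n * (bias_threshold n + 1) < m"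
    by (simp add: m_def)
  \<comment> \<open>The assumption gives \<open>m > 0\<close>, which excludes \<open>n = 0\<close>,
    where \<open>n - 1\<close> is truncated.\<close>
  then have n: "4 * m + 1 \<le> n"
    unfolding m_def by linarith
  have "card W = m" "card Z = m"
    by (simp_all add: W_def Z_def card_image inj_on_def)
  moreover have "{1} \<times> W \<subseteq> parity_tournament n" "W \<times> Z \<subseteq> parity_tournament n"
    "Z \<times> {1} \<subseteq> parity_tournament n"
    using n by (auto simp: W_def Z_def parity_tournament_def)
  moreover have "1 \<notin> W" "1 \<notin> Z" "W \<inter> Z = {}"
    by (auto simp: W_def Z_def)
  ultimately have "\<not> breaker_has_winning_strategy (parity_tournament n) (bias_threshold n)"
    using maker_wins_if_tripartite[OF finite_parity_tournament] b by metis
  then show False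
    using bias_threshold_minimum(2) by blast
qed

text \<open>The bounds obtained are asymptotically \<open>sqrt (n / 4)\<close> and
  \<open>sqrt (2 * n)\<close>. As 1/12 < 1/4 and 2 < 8/3, the slack absorbs all lower-order terms,
  and both error functions can be zero.\<close>

theorem theorem2p2:
  shows "\<exists>f g :: nat \<Rightarrow> real. f \<longlonglongrightarrow> 0 \<and> g \<longlonglongrightarrow> 0 \<and>
    (\<forall>\<^sub>F n in sequentially.
       sqrt ((1 / 12 + f n) * real n) \<le> real (bias_threshold n) \<and>
       real (bias_threshold n) \<le> sqrt ((8 / 3 + g n) * real n))"
proof -
  have "\<forall>\<^sub>F n in sequentially. 2 * real n + 8 + 8 * sqrt (real n / 2 + 1) \<le> 8 / 3 * real n"
    by real_asymp
  then have up: "\<forall>\<^sub>F n in sequentially. 2 * (sqrt (real n / 2 + 1) + 1) \<le> sqrt (8 / 3 * real n)"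
  proof eventually_elim
    case (elim n)
    have "(2 * (sqrt (real n / 2 + 1) + 1))\<^sup>2 = 2 * real n + 8 + 8 * sqrt (real n / 2 + 1)"
      by (simp add: power_mult_distrib power2_sum)
    with elim show ?case
      by (intro real_le_rsqrt) simp
  qed
  have low: "\<forall>\<^sub>F n in sequentially. real n / 12 + sqrt (1 / 12 * real n) < real n / 4 - 1"
    by real_asymp
  have "\<forall>\<^sub>F n in sequentially. sqrt (1 / 12 * real n) \<le> real (bias_threshold n) \<and>
      real (bias_threshold n) \<le> sqrt (8 / 3 * real n)"
    using up low
  proof eventually_elim
    case (elim n)
    let ?b = "real (bias_threshold n)"
    have "sqrt (1 / 12 * real n) \<le> ?b"
    proof (rule ccontr)
      assume "\<not> ?thesis"
      then have less: "?b < sqrt (1 / 12 * real n)" by simp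
      then have "?b\<^sup>2 < 1 / 12 * real n"
        by (metis of_nat_0_le_iff real_less_rsqrt real_sqrt_less_iff real_sqrt_abs abs_of_nonneg)
      moreover have "real n / 4 - 1 \<le> real ((n - 1) div 4)" by linarith
      moreover have "real ((n - 1) div 4) \<le> real (bias_threshold n * (bias_threshold n + 1))"
        using bias_threshold_lower by (simp only: of_nat_le_iff)
      moreover have "real (bias_threshold n * (bias_threshold n + 1)) = ?b\<^sup>2 + ?b"
        by (simp add: power2_eq_square algebra_simps)
      ultimately show False
        using elim(2) less by linarith
    qed
    with bias_threshold_upper[of n] elim(1) show ?case by linarith
  qed
  then show ?thesis
    by (intro exI[of _ "\<lambda>_. 0"]) simp
qed

end
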